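(* Let $A$ and $B$ be maximal abelian *-subalgebras of $M_n(\mathbb{C})$, and let $u\in M_n(\mathbb{C})$ be a unitary with $B=uAu^*$. Let $(u(i,j))_{i,j}$ be the matrix of $u$ with respect to a system of matrix units $\{e_{kl}\}_{k,l=1}^n$ of $M_n(\mathbb{C})$ whose minimal projections $e_{11},\dots,e_{nn}$ generate $A$, and let $b(u)$ be the matrix with entries $b(u)(i,j)=|u(i,j)|^2$. Then $$h(A\mid B)=H(b(u))=\frac1n\sum_{i=1}^n\sum_{j=1}^n\eta\big(|u(i,j)|^2\big).$$
   Context: Let $\eta(t)=-t\log t$ for $t>0$ and $\eta(0)=0$. Let $\tau$ be the normalized trace of $M_n(\mathbb{C})$, and for a unital *-subalgebra $A$ let $E_A$ be the $\tau$-preserving conditional expectation of $M_n(\mathbb{C})$ onto $A$. For unital *-subalgebras $A,B$ of $M_n(\mathbb{C})$, the conditional relative entropy of $A$ and $B$ conditioned by $A$ is $$h(A\mid B)=\sup_{(x_i)}\sum_i\Big(\tau\big(\eta(E_B(E_A(x_i)))\big)-\tau\big(\eta(E_A(x_i))\big)\Big),$$ where the supremum is over all finite families $(x_i)$ of positive elements of $M_n(\mathbb{C})$ with $\sum_i x_i=1$ and $\eta$ is applied by functional calculus. For a bistochastic matrix $b=(b(i,j))\in M_n(\mathbb{C})$ (nonnegative entries, all row sums and column sums equal to $1$), the entropy is $H(b)=\frac1n\sum_{i=1}^n\sum_{j=1}^n\eta(b(i,j))$. *)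

theory Defs
  imports "HOL-Analysis.Analysis"
begin

section \<open>The algebra of complex square matrices\<close>

text \<open>
  \<open>M\<^sub>n(\<complex>)\<close> is the type \<open>complex^'n^'n\<close> with \<open>n = CARD('n)\<close>. Its algebra multiplication
  is \<open>(**)\<close> with unit \<open>mat 1\<close>; the type class operation \<open>(*)\<close> on this type is the entrywise
  product and is not used.
\<close>

definition cscale :: "complex \<Rightarrow> complex^'n^'m \<Rightarrow> complex^'n^'m"  (infixr "*\<^sub>C" 75)
  where "c *\<^sub>C x = (\<chi> i j. c * x $ i $ j)"

definition cadjoint :: "complex^'n^'m \<Rightarrow> complex^'m^'n"
  where "cadjoint x = (\<chi> i j. cnj (x $ j $ i))"

definition unitary :: "complex^'n^'n \<Rightarrow> bool"
  where "unitary u \<longleftrightarrow> cadjoint u ** u = mat 1 \<and> u ** cadjoint u = mat 1"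

definition positive :: "complex^'n^'n \<Rightarrow> bool"
  where "positive x \<longleftrightarrow>
    cadjoint x = x \<and> (\<forall>v. 0 \<le> Re (\<Sum>i\<in>UNIV. cnj (v $ i) * (x *v v) $ i))"

definition norm_trace :: "complex^'n^'n \<Rightarrow> complex"
  where "norm_trace x = trace x / of_nat CARD('n)"

definition diag_mat :: "('n \<Rightarrow> real) \<Rightarrow> complex^'n^'n"
  where "diag_mat d = (\<chi> i j. if i = j then complex_of_real (d i) else 0)"

text \<open>Functional calculus, meant for self-adjoint \<open>x\<close>, by unitary diagonalization. The result
  does not depend on the diagonalization chosen (\<open>fun_calc_diag\<close> below).\<close>

definition fun_calc :: "(real \<Rightarrow> real) \<Rightarrow> complex^'n^'n \<Rightarrow> complex^'n^'n"
  where "fun_calc f x = (THE y. \<exists>u d. unitary u \<and>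
    x = u ** diag_mat d ** cadjoint u \<and> y = u ** diag_mat (f \<circ> d) ** cadjoint u)"


section \<open>Subalgebras and conditional expectations\<close>

definition unital_star_subalgebra :: "(complex^'n^'n) set \<Rightarrow> bool"
  where "unital_star_subalgebra A \<longleftrightarrow> mat 1 \<in> A \<and>
    (\<forall>x\<in>A. \<forall>y\<in>A. x + y \<in> A) \<and> (\<forall>c. \<forall>x\<in>A. c *\<^sub>C x \<in> A) \<and>
    (\<forall>x\<in>A. \<forall>y\<in>A. x ** y \<in> A) \<and> (\<forall>x\<in>A. cadjoint x \<in> A)"

definition abelian_star_subalgebra :: "(complex^'n^'n) set \<Rightarrow> bool"
  where "abelian_star_subalgebra A \<longleftrightarrow>
    unital_star_subalgebra A \<and> (\<forall>x\<in>A. \<forall>y\<in>A. x ** y = y ** x)"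

definition maximal_abelian :: "(complex^'n^'n) set \<Rightarrow> bool"
  where "maximal_abelian A \<longleftrightarrow> abelian_star_subalgebra A \<and>
    (\<forall>C. abelian_star_subalgebra C \<longrightarrow> A \<subseteq> C \<longrightarrow> C = A)"

definition is_cond_exp ::
    "(complex^'n^'n) set \<Rightarrow> (complex^'n^'n \<Rightarrow> complex^'n^'n) \<Rightarrow> bool"
  where "is_cond_exp A E \<longleftrightarrow>
    (\<forall>x y. E (x + y) = E x + E y) \<and> (\<forall>c x. E (c *\<^sub>C x) = c *\<^sub>C E x) \<and>
    (\<forall>x. E x \<in> A) \<and> (\<forall>a\<in>A. E a = a) \<and>
    (\<forall>x. positive x \<longrightarrow> positive (E x)) \<and>
    (\<forall>a\<in>A. \<forall>b\<in>A. \<forall>x. E (a ** x ** b) = a ** E x ** b) \<and>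
    (\<forall>x. norm_trace (E x) = norm_trace x)"

definition cond_exp :: "(complex^'n^'n) set \<Rightarrow> complex^'n^'n \<Rightarrow> complex^'n^'n"
  where "cond_exp A = (THE E. is_cond_exp A E)"

definition matrix_units :: "('n \<Rightarrow> 'n \<Rightarrow> complex^'n^'n) \<Rightarrow> bool"
  where "matrix_units e \<longleftrightarrow>
    (\<forall>i j k l. e i j ** e k l = (if j = k then e i l else 0)) \<and>
    (\<forall>i j. cadjoint (e i j) = e j i) \<and> (\<Sum>i\<in>UNIV. e i i) = mat 1"


section \<open>Entropy\<close>

definition eta :: "real \<Rightarrow> real"
  where "eta t = (if t > 0 then - t * ln t else 0)"

text \<open>The traces below are real, being traces of self-adjoint matrices, so \<open>Re\<close> only changes
  the type. The supremum is taken in the extended reals so that no boundedness is presupposed.\<close>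

definition cond_rel_entropy :: "(complex^'n^'n) set \<Rightarrow> (complex^'n^'n) set \<Rightarrow> ereal"
  where "cond_rel_entropy A B =
    (SUP (m, x) \<in> {(m :: nat, x :: nat \<Rightarrow> complex^'n^'n).
        (\<forall>i<m. positive (x i)) \<and> (\<Sum>i<m. x i) = mat 1}.
      ereal (\<Sum>i<m. Re (norm_trace (fun_calc eta (cond_exp B (cond_exp A (x i)))))
                   - Re (norm_trace (fun_calc eta (cond_exp A (x i))))))"

text \<open>Only meaningful for bistochastic \<open>b\<close>.\<close>

definition bistochastic_entropy :: "real^'n^'n \<Rightarrow> real"
  where "bistochastic_entropy b =
    1 / real CARD('n) * (\<Sum>i\<in>UNIV. \<Sum>j\<in>UNIV. eta (b $ i $ j))"

definition mod_square_matrix :: "complex^'n^'n \<Rightarrow> real^'n^'n"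
  where "mod_square_matrix c = (\<chi> i j. (cmod (c $ i $ j))\<^sup>2)"


section \<open>Well-definedness\<close>

lemma diag_mat_left: "(diag_mat d ** w) $ i $ j = complex_of_real (d i) * w $ i $ j"
  by (simp add: diag_mat_def matrix_matrix_mult_def if_distrib[of "\<lambda>z. z * _"] cong: if_cong)

lemma diag_mat_right: "(w ** diag_mat d) $ i $ j = w $ i $ j * complex_of_real (d j)"
  by (simp add: diag_mat_def matrix_matrix_mult_def if_distrib[of "\<lambda>z. _ * z"] cong: if_cong)

lemma diag_intertwine:
  assumes "w ** diag_mat d = diag_mat d' ** w"
  shows "w ** diag_mat (f \<circ> d) = diag_mat (f \<circ> d') ** w"
proof -
  have "(w ** diag_mat (f \<circ> d)) $ i $ j = (diag_mat (f \<circ> d') ** w) $ i $ j" for i j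
  proof -
    have "w $ i $ j * complex_of_real (d j) = complex_of_real (d' i) * w $ i $ j"
      using assms by (metis diag_mat_left diag_mat_right)
    then have "w $ i $ j = 0 \<or> d j = d' i"
      by (simp add: mult.commute)
    then show ?thesis
      by (auto simp: diag_mat_left diag_mat_right)
  qed
  then show ?thesis
    by (simp add: vec_eq_iff)
qed

lemma fun_calc_diag:
  assumes u: "unitary u"
  shows "fun_calc f (u ** diag_mat d ** cadjoint u) = u ** diag_mat (f \<circ> d) ** cadjoint u"
  unfolding fun_calc_def
proof (rule the_equality)
  show "\<exists>u' d'. unitary u' \<and> u ** diag_mat d ** cadjoint u = u' ** diag_mat d' ** cadjoint u' \<and>
      u ** diag_mat (f \<circ> d) ** cadjoint u = u' ** diag_mat (f \<circ> d') ** cadjoint u'"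
    using u by blast
next
  fix y
  assume "\<exists>v d'. unitary v \<and> u ** diag_mat d ** cadjoint u = v ** diag_mat d' ** cadjoint v \<and>
    y = v ** diag_mat (f \<circ> d') ** cadjoint v"
  then obtain v d' where v: "unitary v"
    and eq: "u ** diag_mat d ** cadjoint u = v ** diag_mat d' ** cadjoint v"
    and y: "y = v ** diag_mat (f \<circ> d') ** cadjoint v" by blast
  define w where "w = cadjoint v ** u"
  have "w ** diag_mat d = cadjoint v ** (u ** diag_mat d ** cadjoint u) ** u"
    using u unfolding w_def unitary_def by (metis matrix_mul_assoc matrix_mul_rid)
  also have "\<dots> = diag_mat d' ** w"
    using v unfolding eq w_def unitary_def by (metis matrix_mul_assoc matrix_mul_lid)
  finally have *: "w ** diag_mat (f \<circ> d) = diag_mat (f \<circ> d') ** w"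
    by (rule diag_intertwine)
  have "y = v ** (diag_mat (f \<circ> d') ** w) ** cadjoint u"
    using u unfolding y w_def unitary_def by (metis matrix_mul_assoc matrix_mul_rid)
  also have "\<dots> = v ** w ** diag_mat (f \<circ> d) ** cadjoint u"
    by (simp add: * [symmetric] matrix_mul_assoc)
  also have "v ** w = u"
    using v unfolding w_def unitary_def by (metis matrix_mul_assoc matrix_mul_lid)
  finally show "y = u ** diag_mat (f \<circ> d) ** cadjoint u" .
qed

lemma trace_mult_cadjoint_eq_0:
  fixes z :: "complex^'n^'n"
  assumes "trace (z ** cadjoint z) = 0"
  shows "z = 0"
proof -
  have "trace (z ** cadjoint z) = of_real (\<Sum>i\<in>UNIV. \<Sum>j\<in>UNIV. (cmod (z $ i $ j))\<^sup>2)"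
    by (simp add: trace_def matrix_matrix_mult_def cadjoint_def complex_norm_square
          del: of_real_power)
  then have "(\<Sum>i\<in>UNIV. \<Sum>j\<in>UNIV. (cmod (z $ i $ j))\<^sup>2) = 0"
    using assms by (metis of_real_eq_0_iff)
  then have "\<forall>i j. z $ i $ j = 0"
    by (simp add: sum_nonneg_eq_0_iff sum_nonneg)
  then show ?thesis
    by (simp add: vec_eq_iff)
qed

lemma cond_exp_eqI:
  fixes E :: "complex^'n^'n \<Rightarrow> complex^'n^'n"
  assumes A: "unital_star_subalgebra A" and E: "is_cond_exp A E"
  shows "cond_exp A = E"
  unfolding cond_exp_def
proof (rule the_equality)
  show "is_cond_exp A E" by (rule E)
next
  fix F assume F: "is_cond_exp A F"
  have tr: "trace (G x ** a) = trace (x ** a)" if "is_cond_exp A G" "a \<in> A" for G x a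
  proof -
    have "mat 1 \<in> A" using A by (simp add: unital_star_subalgebra_def)
    then have "G (x ** a) = G x ** a"
      using that unfolding is_cond_exp_def by (metis matrix_mul_lid)
    moreover have "norm_trace (G (x ** a)) = norm_trace (x ** a)"
      using that unfolding is_cond_exp_def by blast
    ultimately show ?thesis by (simp add: norm_trace_def)
  qed
  show "F = E"
  proof
    fix x
    define z where "z = F x + (- 1) *\<^sub>C E x"
    have z': "z = F x - E x" by (simp add: z_def cscale_def vec_eq_iff)
    have "F x \<in> A" "E x \<in> A" using E F by (auto simp: is_cond_exp_def)
    then have "cadjoint z \<in> A"
      using A unfolding z_def unital_star_subalgebra_def by blast
    then have "trace (F x ** cadjoint z) = trace (E x ** cadjoint z)"
      using tr E F by metis
    moreover have "z ** cadjoint z = F x ** cadjoint z - E x ** cadjoint z"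
      by (simp add: z' matrix_matrix_mult_def vec_eq_iff left_diff_distrib sum_subtractf)
    ultimately have "trace (z ** cadjoint z) = 0"
      by (simp add: trace_sub)
    then show "F x = E x"
      using trace_mult_cadjoint_eq_0 z' by fastforce
  qed
qed

end

theory Submission
  imports Defs
begin

text \<open>
  The matrix units \<open>e\<close> are carried to the standard ones by a unitary \<open>w\<close>, so \<open>A\<close> is \<open>w D w\<^sup>*\<close> for the
  diagonal algebra \<open>D\<close>, \<open>u = w c w\<^sup>*\<close> and \<open>B = (w c) D (w c)\<^sup>*\<close>; the conditional expectations
  are conjugates of the restriction to the diagonal. If \<open>p\<close> is the spectrum of \<open>E\<^sub>A x\<close> and
  \<open>b i j = \<bar>c i j\<bar>\<^sup>2\<close>, then the spectrum of \<open>E\<^sub>B (E\<^sub>A x)\<close> is \<open>q j = (\<Sum>i. b i j * p i)\<close>. Since \<open>\<eta>\<close>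
  is subadditive, \<open>\<eta> (s * t) = s * \<eta> t + t * \<eta> s\<close> and the rows of \<open>b\<close> sum to 1, we get
  \<open>(\<Sum>j. \<eta> (q j)) - (\<Sum>i. \<eta> (p i)) \<le> (\<Sum>i. p i * (\<Sum>j. \<eta> (b i j)))\<close>. Summing over a partition
  of unity gives the upper bound, and the partition into the \<open>e i i\<close> attains it.
\<close>

section \<open>The function \<open>\<eta>\<close>\<close>

lemma eta_mult:
  assumes "0 \<le> s" "0 \<le> t"
  shows "eta (s * t) = s * eta t + t * eta s"
proof (cases "s = 0 \<or> t = 0")
  case False
  then have "0 < s" "0 < t" using assms by auto
  then show ?thesis by (simp add: eta_def ln_mult algebra_simps)
qed (auto simp: eta_def)

text \<open>The logarithm is increasing, so each of \<open>ln s\<close> and \<open>ln t\<close> is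
  at most \<open>ln (s + t)\<close>; weighting these two bounds by \<open>s\<close> and
  \<open>t\<close> and adding gives the claim. If \<open>s\<close> or \<open>t\<close> is zero, use
  \<open>eta 0 = 0\<close>.\<close>

lemma eta_add_le:
  assumes "0 \<le> s" "0 \<le> t"
  shows "eta (s + t) \<le> eta s + eta t"
proof (cases "s = 0 \<or> t = 0")
  case False
  then have st: "0 < s" "0 < t" using assms by auto
  have "s * ln s + t * ln t \<le> (s + t) * ln (s + t)"
    unfolding distrib_right using st by (intro add_mono mult_left_mono) simp_all
  with st show ?thesis by (simp only: eta_def if_True add_pos_pos mult_minus_left)
qed (auto simp: eta_def)

lemma eta_sum_le:
  assumes "\<And>i. i \<in> S \<Longrightarrow> 0 \<le> f i"
  shows "eta (sum f S) \<le> (\<Sum>i\<in>S. eta (f i))"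
  using assms
proof (induction S rule: infinite_finite_induct)
  case (insert x S)
  have "eta (f x + sum f S) \<le> eta (f x) + eta (sum f S)"
    using insert by (intro eta_add_le sum_nonneg) auto
  with insert show ?case by fastforce
qed (simp_all add: eta_def)

section \<open>Adjoints and unitary conjugation\<close>

definition cdot :: "complex^'n \<Rightarrow> complex^'n \<Rightarrow> complex"
  where "cdot v w = (\<Sum>i\<in>UNIV. cnj (v $ i) * w $ i)"

text \<open>For unitary \<open>w\<close> this is a trace-preserving *-automorphism with inverse
  \<open>conjugate (cadjoint w)\<close>. It reduces every statement about \<open>A\<close> and
  \<open>B\<close> to the diagonal algebra.\<close>

definition conjugate :: "complex^'n^'n \<Rightarrow> complex^'n^'n \<Rightarrow> complex^'n^'n"
  where "conjugate w x = w ** x ** cadjoint w"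

lemma cadjoint_cadjoint [simp]: "cadjoint (cadjoint x) = x"
  by (simp add: cadjoint_def vec_eq_iff)

lemma cadjoint_mult: "cadjoint (x ** y) = cadjoint y ** cadjoint x"
  by (simp add: cadjoint_def vec_eq_iff matrix_matrix_mult_def mult.commute)

lemma cdot_mult_right: "cdot v (x *v w) = cdot (cadjoint x *v v) w"
  unfolding cdot_def cadjoint_def matrix_vector_mult_def
  by (simp add: sum_distrib_left sum_distrib_right, subst sum.swap, simp add: mult_ac)

lemma cdot_self: "cdot v v = of_real (\<Sum>i\<in>UNIV. (cmod (v $ i))\<^sup>2)"
  unfolding cdot_def
  by (simp add: complex_norm_square mult.commute del: of_real_power)

lemma positive_iff: "positive x \<longleftrightarrow> cadjoint x = x \<and> (\<forall>v. 0 \<le> Re (cdot v (x *v v)))"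
  by (simp add: positive_def cdot_def)

lemma unitaryD:
  assumes "unitary w"
  shows "cadjoint w ** w = mat 1" "w ** cadjoint w = mat 1"
    "cadjoint w ** (w ** x) = x" "w ** (cadjoint w ** x) = x"
proof -
  show *: "cadjoint w ** w = mat 1" "w ** cadjoint w = mat 1"
    using assms by (simp_all add: unitary_def)
  show "cadjoint w ** (w ** x) = x" "w ** (cadjoint w ** x) = x"
    by (simp_all add: matrix_mul_assoc *)
qed

lemma unitary_cadjoint: "unitary w \<Longrightarrow> unitary (cadjoint w)"
  by (simp add: unitary_def)

lemma unitary_mult: "unitary v \<Longrightarrow> unitary w \<Longrightarrow> unitary (v ** w)"
  unfolding unitary_def[of "v ** w"]
  by (simp add: cadjoint_mult unitaryD flip: matrix_mul_assoc)

lemma cscale_mult: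
  "c *\<^sub>C (x ** y) = (c *\<^sub>C x) ** y" "c *\<^sub>C (x ** y) = x ** (c *\<^sub>C y)"
  by (simp_all add: cscale_def vec_eq_iff matrix_matrix_mult_def sum_distrib_left mult_ac)

lemma matrix_add_rdistrib: "(x + y) ** z = x ** z + y ** (z :: complex^'n^'m)"
  by (simp add: vec_eq_iff matrix_matrix_mult_def distrib_right sum.distrib)

lemma conjugate_add: "conjugate w (x + y) = conjugate w x + conjugate w y"
  by (simp add: conjugate_def matrix_add_ldistrib matrix_add_rdistrib)

lemma conjugate_cscale: "conjugate w (c *\<^sub>C x) = c *\<^sub>C conjugate w x"
  by (simp add: conjugate_def flip: cscale_mult)

lemma conjugate_sum: "conjugate w (\<Sum>i\<in>S. f i) = (\<Sum>i\<in>S. conjugate w (f i))"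
proof (induction S rule: infinite_finite_induct)
  case (insert x S)
  then show ?case by (simp add: conjugate_add)
qed (simp_all add: conjugate_def)

lemma conjugate_cadjoint: "conjugate w (cadjoint x) = cadjoint (conjugate w x)"
  by (simp add: conjugate_def cadjoint_mult matrix_mul_assoc)

lemma conjugate_mult: "unitary w \<Longrightarrow> conjugate w (x ** y) = conjugate w x ** conjugate w y"
  by (simp add: conjugate_def unitaryD flip: matrix_mul_assoc)

lemma conjugate_mat_1: "unitary w \<Longrightarrow> conjugate w (mat 1) = mat 1"
  by (simp add: conjugate_def unitaryD)

lemma conjugate_conjugate: "conjugate v (conjugate w x) = conjugate (v ** w) x"
  by (simp add: conjugate_def cadjoint_mult matrix_mul_assoc)

lemma conjugate_inverse:
  assumes "unitary w"
  shows "conjugate (cadjoint w) (conjugate w x) = x" "conjugate w (conjugate (cadjoint w) x) = x"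
  by (simp_all add: conjugate_def unitaryD assms flip: matrix_mul_assoc)

lemma norm_trace_conjugate: "unitary w \<Longrightarrow> norm_trace (conjugate w x) = norm_trace x"
  unfolding norm_trace_def conjugate_def
  by (subst trace_mul_sym) (simp add: unitaryD)

section \<open>Transport of positivity, subalgebras and conditional expectations\<close>

lemma positive_conjugate:
  assumes "positive x"
  shows "positive (conjugate w x)"
proof -
  have "cdot v (conjugate w x *v v) = cdot (cadjoint w *v v) (x *v (cadjoint w *v v))" for v
    unfolding conjugate_def by (simp add: cdot_mult_right flip: matrix_vector_mul_assoc)
  moreover have "cadjoint (conjugate w x) = conjugate w x"
    using assms by (simp add: positive_iff flip: conjugate_cadjoint)
  ultimately show ?thesis using assms by (simp add: positive_iff)
qed

lemma unital_star_subalgebra_conjugate: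
  assumes A: "unital_star_subalgebra A" and w: "unitary w"
  shows "unital_star_subalgebra (conjugate w ` A)"
  unfolding unital_star_subalgebra_def
proof (intro conjI ballI allI)
  have "mat 1 \<in> A" using A by (simp add: unital_star_subalgebra_def)
  then show "mat 1 \<in> conjugate w ` A"
    using conjugate_mat_1[OF w] by (metis image_eqI)
qed (use A in \<open>auto simp: unital_star_subalgebra_def
      simp flip: conjugate_mult[OF w] conjugate_add conjugate_cscale conjugate_cadjoint\<close>)

text \<open>The defining properties are stable under *-automorphisms preserving trace and
  positivity: pull \<open>x\<close> back to the side of \<open>A\<close>, apply \<open>E\<close>
  there, and push the result forward.\<close>

lemma is_cond_exp_conjugate:
  assumes E: "is_cond_exp A E" and w: "unitary w"
  shows "is_cond_exp (conjugate w ` A) (\<lambda>x. conjugate w (E (conjugate (cadjoint w) x)))"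
proof -
  note inv = conjugate_inverse[OF w]
  note mult = conjugate_mult[OF unitary_cadjoint[OF w]]
  show ?thesis
    using E unfolding is_cond_exp_def
    by (auto simp: conjugate_add conjugate_cscale inv mult norm_trace_conjugate
        unitary_cadjoint w positive_conjugate simp flip: conjugate_mult[OF w])
qed

section \<open>The diagonal algebra\<close>

text \<open>Plays two roles: its range is the diagonal algebra, and the map itself is the
  conditional expectation onto that algebra.\<close>

definition pinch :: "complex^'n^'n \<Rightarrow> complex^'n^'n"
  where "pinch x = (\<chi> i j. if i = j then x $ i $ j else 0)"

lemma pinch_nth: "pinch x $ i $ j = (if i = j then x $ i $ j else 0)"
  by (simp add: pinch_def)

lemma pinch_mult_left: "(pinch a ** x) $ i $ j = a $ i $ i * x $ i $ j"
  by (simp add: pinch_def matrix_matrix_mult_def if_distrib[of "\<lambda>z. z * _"] cong: if_cong)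

lemma pinch_mult_right: "(x ** pinch a) $ i $ j = x $ i $ j * a $ j $ j"
  by (simp add: pinch_def matrix_matrix_mult_def if_distrib[of "\<lambda>z. _ * z"] cong: if_cong)

lemma unital_star_subalgebra_pinch: "unital_star_subalgebra (range pinch :: (complex^'n^'n) set)"
proof -
  have "mat 1 = pinch (mat 1 :: complex^'n^'n)"
    by (simp add: pinch_def vec_eq_iff mat_def)
  moreover have "pinch x + pinch y = pinch (x + y)" "c *\<^sub>C pinch x = pinch (c *\<^sub>C x)"
    "cadjoint (pinch x) = pinch (cadjoint x)" for x y :: "complex^'n^'n" and c
    by (auto simp: pinch_def vec_eq_iff cscale_def cadjoint_def)
  \<comment> \<open>\<open>pinch\<close> is not multiplicative, only a bimodule map over its range,
    so one factor on the right stays pinched.\<close>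
  moreover have "pinch x ** pinch y = pinch (x ** pinch y)" for x y :: "complex^'n^'n"
    by (simp add: vec_eq_iff pinch_mult_left pinch_mult_right pinch_nth)
  ultimately show ?thesis
    unfolding unital_star_subalgebra_def by (auto intro: range_eqI)
qed

lemma axis_nth_if: "axis i a $ j = (if j = i then a else 0)"
  by (simp add: axis_def)

lemma positive_diagonal:
  assumes "positive x"
  shows "x $ i $ i = of_real (Re (x $ i $ i))" "0 \<le> Re (x $ i $ i)"
proof -
  have "cadjoint x $ i $ i = x $ i $ i" using assms by (simp add: positive_def)
  then show "x $ i $ i = of_real (Re (x $ i $ i))"
    by (simp add: cadjoint_def complex_eq_iff)
  \<comment> \<open>The quadratic form of \<open>x\<close> at the \<open>i\<close>-th basis vector
    is the diagonal entry \<open>x $ i $ i\<close>.\<close>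
  have "(x *v axis i 1) $ k = x $ k $ i" for k
    by (simp add: matrix_vector_mult_def axis_nth_if if_distrib[of "\<lambda>z. _ * z"] cong: if_cong)
  then have "cdot (axis i 1) (x *v axis i 1) = x $ i $ i"
    by (simp add: cdot_def if_distrib[of cnj] axis_nth_if
        if_distrib[of "\<lambda>z. z * _"] cong: if_cong)
  moreover have "0 \<le> Re (cdot (axis i 1) (x *v axis i 1))"
    using assms by (simp add: positive_iff)
  ultimately show "0 \<le> Re (x $ i $ i)" by simp
qed

lemma pinch_positive:
  assumes "positive x"
  shows "pinch x = diag_mat (\<lambda>i. Re (x $ i $ i))"
  using positive_diagonal(1)[OF assms] by (simp add: pinch_def diag_mat_def vec_eq_iff)

lemma positive_diag_mat:
  assumes "\<And>i. 0 \<le> d i"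
  shows "positive (diag_mat d)"
proof -
  have "(diag_mat d *v v) $ i = of_real (d i) * v $ i" for v i
    by (simp add: diag_mat_def matrix_vector_mult_def if_distrib[of "\<lambda>z. z * _"] cong: if_cong)
  then have "cdot v (diag_mat d *v v) = of_real (\<Sum>i\<in>UNIV. d i * (cmod (v $ i))\<^sup>2)" for v
    by (simp add: cdot_def complex_norm_square mult_ac del: of_real_power)
  then show ?thesis
    using assms by (simp add: positive_iff sum_nonneg) (simp add: cadjoint_def diag_mat_def vec_eq_iff)
qed

lemma is_cond_exp_pinch: "is_cond_exp (range pinch) pinch"
  unfolding is_cond_exp_def
proof (intro conjI ballI allI impI)
  fix x :: "complex^'n^'n" assume "positive x"
  then show "positive (pinch x)"
    using positive_diagonal(2) by (auto simp: pinch_positive intro!: positive_diag_mat)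
next
  fix a b x :: "complex^'n^'n" assume "a \<in> range pinch" "b \<in> range pinch"
  then show "pinch (a ** x ** b) = a ** pinch x ** b"
    by (auto simp: vec_eq_iff pinch_mult_left pinch_mult_right pinch_nth)
qed (auto simp: pinch_def vec_eq_iff cscale_def norm_trace_def trace_def)

text \<open>The conjugated pinching is a conditional expectation onto the conjugated diagonal
  algebra, and \<open>cond_exp_eqI\<close> says that there is only one.\<close>

lemma cond_exp_diagonal:
  assumes "unitary w"
  shows "cond_exp (conjugate w ` range pinch) x = conjugate w (pinch (conjugate (cadjoint w) x))"
  using cond_exp_eqI[OF unital_star_subalgebra_conjugate[OF unital_star_subalgebra_pinch assms]
      is_cond_exp_conjugate[OF is_cond_exp_pinch assms]]
  by simp

text \<open>Makes the entropy terms depend on the spectrum alone: functional calculus commutes with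
  unitary conjugation, which the trace does not see.\<close>

lemma norm_trace_fun_calc_conjugate:
  fixes w :: "complex^'n^'n"
  assumes "unitary w"
  shows "norm_trace (fun_calc f (conjugate w (diag_mat d))) =
    of_real (1 / real CARD('n) * (\<Sum>i\<in>UNIV. f (d i)))"
proof -
  have "fun_calc f (conjugate w (diag_mat d)) = conjugate w (diag_mat (f \<circ> d))"
    by (simp add: conjugate_def fun_calc_diag assms)
  then show ?thesis
    by (simp add: norm_trace_conjugate[OF assms]) (simp add: norm_trace_def trace_def diag_mat_def)
qed

section \<open>Matrix units\<close>

definition std_unit :: "'n \<Rightarrow> 'n \<Rightarrow> complex^'n^'n"
  where "std_unit i j = (\<chi> k l. if k = i \<and> l = j then 1 else 0)"

lemma sum_std_unit: "(\<Sum>i\<in>UNIV. \<Sum>j\<in>UNIV. (x $ i $ j) *\<^sub>C std_unit i j) = x"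
proof -
  have "(\<Sum>i\<in>UNIV. \<Sum>j\<in>UNIV. x $ i $ j * (if k = i \<and> l = j then 1 else 0)) = x $ k $ l" for k l
  proof -
    have "(\<Sum>j\<in>UNIV. x $ i $ j * (if k = i \<and> l = j then 1 else 0)) =
        (if k = i then x $ k $ l else 0)" for i
      by (auto simp: if_distrib cong: if_cong)
    then show ?thesis by simp
  qed
  then show ?thesis by (simp add: vec_eq_iff cscale_def std_unit_def)
qed

text \<open>The columns of \<open>w\<close> are \<open>e j k v\<close> for a fixed \<open>k\<close> and a unit vector \<open>v\<close> in the range of \<open>e k k\<close>.\<close>

lemma matrix_units_conjugate:
  fixes e :: "'n \<Rightarrow> 'n \<Rightarrow> complex^'n^'n"
  assumes e: "matrix_units e"
  obtains w where "unitary w" "\<And>i j. e i j = conjugate w (std_unit i j)"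
proof -
  have mult: "e i j ** e k l = (if j = k then e i l else 0)" for i j k l
    using e by (simp add: matrix_units_def)
  have adj: "cadjoint (e i j) = e j i" for i j
    using e by (simp add: matrix_units_def)
  define k :: 'n where "k = undefined"
  \<comment> \<open>Otherwise every \<open>e i i\<close>, being
    \<open>e i k ** e k k ** e k i\<close>, would vanish, and so would their sum, the unit.\<close>
  have "e k k \<noteq> 0"
  proof
    assume "e k k = 0"
    then have "e i i = 0" for i
      using mult[of i k k k] mult[of i k k i] by simp
    then have "(mat 1 :: complex^'n^'n) = 0"
      using e by (simp add: matrix_units_def)
    then have "(mat 1 :: complex^'n^'n) $ k $ k = 0" by simp
    then show False by (simp add: mat_def)
  qed
  then obtain y where "e k k *v y \<noteq> 0"
    by (metis matrix_eq matrix_vector_mult_0)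
  define z where "z = e k k *v y"
  define r where "r = (\<Sum>i\<in>UNIV. (cmod (z $ i))\<^sup>2)"
  have "z \<noteq> 0" using \<open>e k k *v y \<noteq> 0\<close> by (simp add: z_def)
  then have "r \<noteq> 0" by (simp add: r_def sum_nonneg_eq_0_iff vec_eq_iff)
  moreover have "r \<ge> 0" by (simp add: r_def sum_nonneg)
  ultimately have "r > 0" by simp
  define v where "v = of_real (1 / sqrt r) *s z"
  have "cdot v v = of_real (1 / sqrt r * (1 / sqrt r) * r)"
    by (simp add: v_def cdot_self r_def norm_mult power_mult_distrib norm_divide power_divide
        flip: sum_divide_distrib power2_eq_square)
  with \<open>r > 0\<close> have vv: "cdot v v = 1" by simp
  have ev: "e k k *v v = v"
    by (simp add: v_def z_def vector_scalar_commute matrix_vector_mul_assoc mult)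
  define w where "w = (\<chi> i j. (e j k *v v) $ i)"
  have "(cadjoint w ** w) $ i $ j = cdot (e i k *v v) (e j k *v v)" for i j
    by (simp add: w_def cadjoint_def matrix_matrix_mult_def cdot_def)
  \<comment> \<open>Moving \<open>e i k\<close> to the other side produces
    \<open>e k i ** e j k\<close>, which is \<open>e k k\<close> or zero, and \<open>e k k\<close>
    fixes the unit vector \<open>v\<close>.\<close>
  also have "cdot (e i k *v v) (e j k *v v) = (if i = j then 1 else 0)" for i j
  proof -
    have "cdot (e i k *v v) (e j k *v v) = cdot v (e k i *v (e j k *v v))"
      by (simp add: cdot_mult_right[of v "e k i"] adj)
    then show ?thesis
      by (simp add: matrix_vector_mul_assoc mult ev vv) (simp add: cdot_def)
  qed
  finally have "cadjoint w ** w = mat 1"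
    by (simp add: vec_eq_iff mat_def)
  then have w: "unitary w"
    by (simp add: unitary_def matrix_left_right_inverse)
  \<comment> \<open>Column by column: \<open>e i j\<close> sends column \<open>j\<close> of
    \<open>w\<close> to column \<open>i\<close> and kills the other columns.\<close>
  have "e i j ** w = w ** std_unit i j" for i j
  proof -
    have "(e i j ** w) $ a $ l = (e i j *v (e l k *v v)) $ a" for a l
      by (simp add: w_def matrix_matrix_mult_def matrix_vector_mult_def)
    also have "(e i j *v (e l k *v v)) $ a = (w ** std_unit i j) $ a $ l" for a l
      by (simp add: matrix_vector_mul_assoc mult)
        (auto simp: w_def std_unit_def matrix_matrix_mult_def if_distrib cong: if_cong)
    finally show ?thesis by (simp add: vec_eq_iff)
  qed
  then have "e i j = conjugate w (std_unit i j)" for i j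
    unfolding conjugate_def by (metis matrix_mul_assoc matrix_mul_rid unitaryD(2)[OF w])
  with w show ?thesis by (rule that)
qed

section \<open>The algebra generated by the diagonal matrix units\<close>

lemma unital_star_subalgebra_sum:
  assumes T: "unital_star_subalgebra T" and f: "\<And>i. i \<in> S \<Longrightarrow> f i \<in> T"
  shows "sum f S \<in> T"
  using f
proof (induction S rule: infinite_finite_induct)
  case (insert x S)
  then show ?case using T by (simp add: unital_star_subalgebra_def)
next
  \<comment> \<open>The zero matrix, the value of empty and of infinite sums, lies in
    \<open>T\<close> as a multiple of the unit.\<close>
  have "0 *\<^sub>C mat 1 \<in> T" using T by (simp add: unital_star_subalgebra_def)
  moreover have "0 *\<^sub>C mat 1 = (0 :: complex^'a^'a)" by (simp add: cscale_def vec_eq_iff)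
  ultimately have "0 \<in> T" by simp
  then show "sum f {} \<in> T" "infinite S \<Longrightarrow> sum f S \<in> T" for S by simp_all
qed

text \<open>A diagonal matrix is a linear combination of the \<open>std_unit k k\<close>, so any
  subalgebra containing their conjugates contains the whole conjugated diagonal algebra.\<close>

lemma hull_std_unit:
  fixes w :: "complex^'n^'n"
  assumes w: "unitary w"
  shows "unital_star_subalgebra hull (range (\<lambda>k. conjugate w (std_unit k k))) =
    conjugate w ` range pinch" (is "_ hull ?S = ?D")
proof (rule hull_unique)
  show "?S \<subseteq> ?D"
  proof
    fix x assume "x \<in> ?S"
    then obtain k where "x = conjugate w (std_unit k k)" by auto
    moreover have "std_unit k k = pinch (std_unit k k)"
      by (auto simp: std_unit_def pinch_def vec_eq_iff)
    ultimately show "x \<in> ?D" by blast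
  qed
  show "unital_star_subalgebra ?D"
    using unital_star_subalgebra_pinch w by (rule unital_star_subalgebra_conjugate)
  fix T assume T: "?S \<subseteq> T" "unital_star_subalgebra T"
  show "?D \<subseteq> T"
  proof safe
    fix x :: "complex^'n^'n"
    have "pinch x $ k $ l = (\<Sum>i\<in>UNIV. (x $ i $ i) *\<^sub>C std_unit i i) $ k $ l" for k l
    proof -
      have "(\<Sum>i\<in>UNIV. (x $ i $ i) *\<^sub>C std_unit i i) $ k $ l =
          (\<Sum>i\<in>UNIV. if i = k then pinch x $ k $ l else 0)"
        unfolding sum_component by (rule sum.cong) (auto simp: cscale_def std_unit_def pinch_nth)
      then show ?thesis by simp
    qed
    then have "pinch x = (\<Sum>i\<in>UNIV. (x $ i $ i) *\<^sub>C std_unit i i)"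
      by (simp add: vec_eq_iff)
    then have "conjugate w (pinch x) = (\<Sum>i\<in>UNIV. (x $ i $ i) *\<^sub>C conjugate w (std_unit i i))"
      by (simp add: conjugate_sum conjugate_cscale)
    also have "\<dots> \<in> T"
    proof (rule unital_star_subalgebra_sum[OF T(2)])
      fix i
      have "conjugate w (std_unit i i) \<in> T" using T(1) by blast
      then show "(x $ i $ i) *\<^sub>C conjugate w (std_unit i i) \<in> T"
        using T(2) by (simp add: unital_star_subalgebra_def)
    qed
    finally show "conjugate w (pinch x) \<in> T" .
  qed
qed

section \<open>The conditional relative entropy\<close>

text \<open>Row sums are the diagonal entries of \<open>c ** cadjoint c\<close>, the unit
  matrix.\<close>

lemma unitary_row_sum:
  assumes "unitary c"
  shows "(\<Sum>j\<in>UNIV. (cmod (c $ i $ j))\<^sup>2) = 1"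
proof -
  have "(c ** cadjoint c) $ i $ i = of_real (\<Sum>j\<in>UNIV. (cmod (c $ i $ j))\<^sup>2)"
    by (simp add: matrix_matrix_mult_def cadjoint_def complex_norm_square del: of_real_power)
  then have "complex_of_real (\<Sum>j\<in>UNIV. (cmod (c $ i $ j))\<^sup>2) = 1"
    using assms by (simp add: unitaryD mat_def)
  then show ?thesis by (metis of_real_eq_1_iff)
qed

lemma eta_stochastic_le:
  fixes b :: "'i::finite \<Rightarrow> 'j::finite \<Rightarrow> real"
  assumes b: "\<And>i j. 0 \<le> b i j" "\<And>i. (\<Sum>j\<in>UNIV. b i j) = 1" and p: "\<And>i. 0 \<le> p i"
  shows "(\<Sum>j\<in>UNIV. eta (\<Sum>i\<in>UNIV. b i j * p i)) - (\<Sum>i\<in>UNIV. eta (p i)) \<le>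
    (\<Sum>i\<in>UNIV. p i * (\<Sum>j\<in>UNIV. eta (b i j)))"
proof -
  have "(\<Sum>j\<in>UNIV. eta (\<Sum>i\<in>UNIV. b i j * p i)) \<le> (\<Sum>j\<in>UNIV. \<Sum>i\<in>UNIV. eta (b i j * p i))"
    using b p by (intro sum_mono eta_sum_le) auto
  also have "\<dots> = (\<Sum>i\<in>UNIV. \<Sum>j\<in>UNIV. b i j * eta (p i) + p i * eta (b i j))"
    by (subst sum.swap) (simp add: eta_mult b p)
  \<comment> \<open>Since row \<open>i\<close> of \<open>b\<close> sums to 1,
    \<open>eta (p i)\<close> gets total weight 1 and will cancel against the subtracted sum.\<close>
  also have "\<dots> = (\<Sum>i\<in>UNIV. eta (p i)) + (\<Sum>i\<in>UNIV. p i * (\<Sum>j\<in>UNIV. eta (b i j)))"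
    by (simp add: sum.distrib b(2) flip: sum_distrib_left sum_distrib_right)
  finally show ?thesis by simp
qed

lemma diagonal_conjugate_diag_mat:
  "conjugate (cadjoint c) (diag_mat p) $ j $ j =
    of_real (\<Sum>i\<in>UNIV. (cmod (c $ i $ j))\<^sup>2 * p i)"
proof -
  have "conjugate (cadjoint c) (diag_mat p) $ j $ j =
      (\<Sum>i\<in>UNIV. cadjoint c $ j $ i * (diag_mat p ** c) $ i $ j)"
    by (simp add: conjugate_def flip: matrix_mul_assoc)
      (simp add: matrix_matrix_mult_def)
  also have "\<dots> = (\<Sum>i\<in>UNIV. of_real ((cmod (c $ i $ j))\<^sup>2 * p i))"
    by (simp add: diag_mat_left cadjoint_def complex_norm_square mult_ac del: of_real_power)
  finally show ?thesis by simp
qed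

text \<open>Turns a summand of the supremum into a function of the vector \<open>p\<close>, the
  spectrum of \<open>cond_exp A x\<close>, and of the squared moduli of \<open>c\<close>.\<close>

lemma entropy_difference:
  fixes w c x :: "complex^'n^'n"
  assumes w: "unitary w" and c: "unitary c" and x: "positive x"
    and A: "A = conjugate w ` range pinch" and B: "B = conjugate (w ** c) ` range pinch"
  defines "p \<equiv> \<lambda>i. Re (conjugate (cadjoint w) x $ i $ i)"
  shows "Re (norm_trace (fun_calc eta (cond_exp B (cond_exp A x))))
      - Re (norm_trace (fun_calc eta (cond_exp A x))) =
    1 / real CARD('n) * ((\<Sum>j\<in>UNIV. eta (\<Sum>i\<in>UNIV. (cmod (c $ i $ j))\<^sup>2 * p i))
      - (\<Sum>i\<in>UNIV. eta (p i)))"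
proof -
  have wc: "unitary (w ** c)" using w c by (rule unitary_mult)
  have y: "positive (conjugate (cadjoint w) x)" using x by (rule positive_conjugate)
  have EA: "cond_exp A x = conjugate w (diag_mat p)"
    by (simp add: A cond_exp_diagonal[OF w] pinch_positive[OF y] p_def)
  have "positive (diag_mat p)"
    using positive_diagonal(2)[OF y] by (intro positive_diag_mat) (simp add: p_def)
  then have "positive (conjugate (cadjoint c) (diag_mat p))" by (rule positive_conjugate)
  note pinch = pinch_positive[OF this]
  \<comment> \<open>Passing from the frame of \<open>A\<close> to that of \<open>B\<close> cancels
    \<open>w\<close> and leaves only the conjugation by \<open>cadjoint c\<close>.\<close>
  have "conjugate (cadjoint (w ** c)) (conjugate w (diag_mat p)) =
      conjugate (cadjoint c) (diag_mat p)"
    by (simp add: conjugate_conjugate cadjoint_mult unitaryD[OF w] flip: matrix_mul_assoc)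
  then have EB: "cond_exp B (cond_exp A x) =
      conjugate (w ** c) (diag_mat (\<lambda>j. \<Sum>i\<in>UNIV. (cmod (c $ i $ j))\<^sup>2 * p i))"
    unfolding EA
    by (simp only: B cond_exp_diagonal[OF wc] pinch diagonal_conjugate_diag_mat Re_complex_of_real)
  show ?thesis
    unfolding EB
    unfolding EA norm_trace_fun_calc_conjugate[OF wc] norm_trace_fun_calc_conjugate[OF w]
    by (simp only: Re_complex_of_real right_diff_distrib)
qed

section \<open>The equality: reduction to the diagonal, upper bound, attainment\<close>

theorem corollary4:
  fixes A B :: "(complex^'n^'n) set"
    and u :: "complex^'n^'n"
    and e :: "'n \<Rightarrow> 'n \<Rightarrow> complex^'n^'n"
    and c :: "complex^'n^'n"
  assumes "maximal_abelian A" and "maximal_abelian B"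
    and "unitary u"
    and "B = (\<lambda>a. u ** a ** cadjoint u) ` A"
    and "matrix_units e"
    and "A = unital_star_subalgebra hull (range (\<lambda>k. e k k))"
    and "u = (\<Sum>i\<in>UNIV. \<Sum>j\<in>UNIV. (c $ i $ j) *\<^sub>C e i j)"
  shows "cond_rel_entropy A B = ereal (bistochastic_entropy (mod_square_matrix c)) \<and>
    bistochastic_entropy (mod_square_matrix c) =
      1 / real CARD('n) * (\<Sum>i\<in>UNIV. \<Sum>j\<in>UNIV. eta ((cmod (c $ i $ j))\<^sup>2))"
proof -
  obtain w where w: "unitary w" and e: "\<And>i j. e i j = conjugate w (std_unit i j)"
    using matrix_units_conjugate[OF assms(5)] by blast
  have "conjugate w c = conjugate w (\<Sum>i\<in>UNIV. \<Sum>j\<in>UNIV. (c $ i $ j) *\<^sub>C std_unit i j)"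
    by (simp only: sum_std_unit)
  then have u: "u = conjugate w c"
    by (simp add: assms(7) e conjugate_sum conjugate_cscale)
  then have "c = conjugate (cadjoint w) u" by (simp add: conjugate_inverse w)
  then have c: "unitary c"
    using w \<open>unitary u\<close> by (simp add: conjugate_def unitary_mult unitary_cadjoint)
  have A: "A = conjugate w ` range pinch"
    by (simp only: assms(6) e hull_std_unit[OF w])
  have "B = conjugate u ` A"
    by (simp add: assms(4) conjugate_def[abs_def])
  \<comment> \<open>As \<open>u\<close> is \<open>w ** c ** cadjoint w\<close>, conjugating by
    \<open>u\<close> after \<open>w\<close> amounts to conjugating by \<open>w ** c\<close>.\<close>
  moreover have "u ** w = w ** c"
    by (simp add: u conjugate_def unitaryD[OF w] flip: matrix_mul_assoc)
  ultimately have B: "B = conjugate (w ** c) ` range pinch"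
    by (simp add: A image_image conjugate_conjugate)
  define h where "h x = Re (norm_trace (fun_calc eta (cond_exp B (cond_exp A x))))
      - Re (norm_trace (fun_calc eta (cond_exp A x)))" for x :: "complex^'n^'n"
  define p where "p x i = Re (conjugate (cadjoint w) x $ i $ i)" for x :: "complex^'n^'n" and i
  define b where "b i j = (cmod (c $ i $ j))\<^sup>2" for i j
  define H where "H = 1 / real CARD('n) * (\<Sum>i\<in>UNIV. \<Sum>j\<in>UNIV. eta (b i j))"
  have h: "h x = 1 / real CARD('n) *
      ((\<Sum>j\<in>UNIV. eta (\<Sum>i\<in>UNIV. b i j * p x i)) - (\<Sum>i\<in>UNIV. eta (p x i)))"
    if "positive x" for x
    unfolding h_def p_def b_def by (rule entropy_difference[OF w c that A B])
  have upper: "(\<Sum>k<m. h (x k)) \<le> H"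
    if pos: "\<forall>k<m. positive (x k)" and sum: "(\<Sum>k<m. x k) = mat 1"
    for m and x :: "nat \<Rightarrow> complex^'n^'n"
  proof -
    \<comment> \<open>The conjugated family is again a partition of unity, so its
      \<open>i\<close>-th diagonal entries sum to 1. After exchanging sums, this gives each row
      entropy of \<open>b\<close> weight 1.\<close>
    have p1: "(\<Sum>k<m. p (x k) i) = 1" for i
    proof -
      have "(\<Sum>k<m. p (x k) i) = p (\<Sum>k<m. x k) i"
        by (simp add: p_def conjugate_sum)
      then show ?thesis
        by (simp add: sum p_def conjugate_mat_1 unitary_cadjoint w) (simp add: mat_def)
    qed
    have "h (x k) \<le> 1 / real CARD('n) * (\<Sum>i\<in>UNIV. p (x k) i * (\<Sum>j\<in>UNIV. eta (b i j)))"
      if "k < m" for k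
    proof -
      have x: "positive (x k)" using pos that by blast
      have "0 \<le> p (x k) i" for i
        unfolding p_def by (intro positive_diagonal(2) positive_conjugate x)
      then show ?thesis
        unfolding h[OF x]
        by (intro mult_left_mono eta_stochastic_le) (simp_all add: b_def unitary_row_sum[OF c])
    qed
    then have "(\<Sum>k<m. h (x k)) \<le>
        (\<Sum>k<m. 1 / real CARD('n) * (\<Sum>i\<in>UNIV. p (x k) i * (\<Sum>j\<in>UNIV. eta (b i j))))"
      by (intro sum_mono) simp
    also have "\<dots> = 1 / real CARD('n) * (\<Sum>i\<in>UNIV. (\<Sum>k<m. p (x k) i) * (\<Sum>j\<in>UNIV. eta (b i j)))"
      unfolding sum_distrib_left[symmetric] sum_distrib_right by (subst sum.swap) simp
    also have "\<dots> = H" by (simp add: p1 H_def)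
    finally show ?thesis .
  qed
  \<comment> \<open>Families in the supremum are indexed by the numbers below \<open>m\<close>, so
    the \<open>e i i\<close> are enumerated along a bijection.\<close>
  obtain g where g: "bij_betw g {..<CARD('n)} (UNIV :: 'n set)"
    using ex_bij_betw_nat_finite[of "UNIV :: 'n set"] by (auto simp: atLeast0LessThan)
  define x where "x k = e (g k) (g k)" for k
  have std: "std_unit i i = diag_mat (\<lambda>j. if j = i then 1 else 0)" for i :: 'n
    by (auto simp: std_unit_def diag_mat_def vec_eq_iff)
  have pos: "positive (e i i)" for i
    unfolding e std by (intro positive_conjugate positive_diag_mat) simp
  have p_unit: "p (e i i) j = (if j = i then 1 else 0)" for i j
    by (simp add: p_def e conjugate_inverse w std_unit_def)
  \<comment> \<open>\<open>eta\<close> vanishes at both 0 and 1, so the subtracted entropy is zero;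
    the other spectrum is row \<open>i\<close> of \<open>b\<close>, hence equality holds for
    \<open>e i i\<close>.\<close>
  have "eta (p (e i i) j) = 0" for i j
    by (simp add: p_unit eta_def)
  then have "h (e i i) = 1 / real CARD('n) * (\<Sum>j\<in>UNIV. eta (b i j))" for i
    unfolding h[OF pos] by (simp add: p_unit if_distrib[of "\<lambda>z. _ * z"] cong: if_cong)
  then have "(\<Sum>i\<in>UNIV. h (e i i)) = H"
    by (simp add: H_def sum_distrib_left)
  then have attained: "(\<Sum>k<CARD('n). h (x k)) = H"
    unfolding x_def using sum.reindex_bij_betw[OF g, of "\<lambda>i. h (e i i)"] by simp
  have pos_x: "positive (x k)" for k
    unfolding x_def by (rule pos)
  have one: "(\<Sum>k<CARD('n). x k) = mat 1"
    unfolding x_def using sum.reindex_bij_betw[OF g, of "\<lambda>i. e i i"] assms(5)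
    by (simp add: matrix_units_def)
  have "cond_rel_entropy A B = ereal H"
    unfolding cond_rel_entropy_def h_def[symmetric]
  proof (rule antisym)
    show "(SUP (m, x)\<in>{(m :: nat, x). (\<forall>i<m. positive (x i)) \<and> (\<Sum>i<m. x i) = mat 1}.
        ereal (\<Sum>i<m. h (x i))) \<le> ereal H"
      by (rule SUP_least) (clarsimp simp: upper)
    show "ereal H \<le> (SUP (m, x)\<in>{(m :: nat, x). (\<forall>i<m. positive (x i)) \<and> (\<Sum>i<m. x i) = mat 1}.
        ereal (\<Sum>i<m. h (x i)))"
      by (rule SUP_upper2[where i = "(CARD('n), x)"]) (simp_all add: one attained pos_x)
  qed
  moreover have "bistochastic_entropy (mod_square_matrix c) = H"
    by (simp add: bistochastic_entropy_def mod_square_matrix_def H_def b_def)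
  ultimately show ?thesis by (simp add: H_def b_def)
qed

end
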